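(* In the two-seller, one-buyer game with qualities $Q_1\ge Q_2\ge0$, when none of the sellers chooses to disclose information ($\alpha_1=\alpha_2=0$), the game degenerates into a simple pricing competition, in which (at equilibrium) both sellers set their prices to zero, $p_1^*=p_2^*=0$, and both obtain a zero profit.
   Context: Model. Two sellers $i\in\{1,2\}$ with true qualities $Q_i$ and marginal privacy costs $c_i\ge 0$ compete for one buyer. Seller $i$ has disclosure level $\alpha_i\in[0,1]$ and chooses a price $p_i\in[0,\infty)$; write $\boldsymbol\alpha=(\alpha_1,\alpha_2)$, $\boldsymbol p=(p_1,p_2)$. The buyer has an average prior belief $Q_0$ on quality and a random estimation bias $\epsilon\sim U(-\epsilon_0,\epsilon_0)$, $0<\epsilon_0\le Q_0/3$, unknown to the sellers. Choosing seller $i$ gives the buyer payoff $U_i=\alpha_iQ_i+(1-\alpha_i)(Q_0+\epsilon)-p_i$; she picks the seller with the larger payoff, ties being broken with probability $1/2$ each. Let $Pr_i(\boldsymbol\alpha,\boldsymbol p,\epsilon)$ be the resulting winning probability of seller $i$. Seller $i$'s expected profit is $E_\epsilon[p_i\,Pr_i(\boldsymbol\alpha,\boldsymbol p,\epsilon)-c_i\alpha_i]$. In the pricing game, for given $\boldsymbol\alpha$, sellers simultaneously choose prices to maximize expected profit; $(p_1^*,p_2^* )$ is a pure Nash equilibrium of this game. *)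

theory Defs
  imports "HOL-Probability.Probability"
begin

datatype seller = S1 | S2

fun rival :: "seller \<Rightarrow> seller" where
  "rival S1 = S2"
| "rival S2 = S1"

definition buyer_payoff ::
  "(seller \<Rightarrow> real) \<Rightarrow> real \<Rightarrow> (seller \<Rightarrow> real) \<Rightarrow> (seller \<Rightarrow> real) \<Rightarrow> real \<Rightarrow> seller \<Rightarrow> real" where
  "buyer_payoff Q Q0 \<alpha> p \<epsilon> i = \<alpha> i * Q i + (1 - \<alpha> i) * (Q0 + \<epsilon>) - p i"

(* There is no outside option: the buyer always buys from one of the two sellers. *)
definition win_prob ::
  "(seller \<Rightarrow> real) \<Rightarrow> real \<Rightarrow> (seller \<Rightarrow> real) \<Rightarrow> (seller \<Rightarrow> real) \<Rightarrow> real \<Rightarrow> seller \<Rightarrow> real" where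
  "win_prob Q Q0 \<alpha> p \<epsilon> i =
     (if buyer_payoff Q Q0 \<alpha> p \<epsilon> (rival i) < buyer_payoff Q Q0 \<alpha> p \<epsilon> i then 1
      else if buyer_payoff Q Q0 \<alpha> p \<epsilon> i = buyer_payoff Q Q0 \<alpha> p \<epsilon> (rival i) then 1 / 2
      else 0)"

definition bias_distr :: "real \<Rightarrow> real measure" where
  "bias_distr \<epsilon>0 = uniform_measure lborel {- \<epsilon>0 <..< \<epsilon>0}"

definition expected_profit ::
  "(seller \<Rightarrow> real) \<Rightarrow> (seller \<Rightarrow> real) \<Rightarrow> real \<Rightarrow> real \<Rightarrow>
   (seller \<Rightarrow> real) \<Rightarrow> (seller \<Rightarrow> real) \<Rightarrow> seller \<Rightarrow> real" where
  "expected_profit Q c Q0 \<epsilon>0 \<alpha> p i =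
     (\<integral>\<epsilon>. (p i * win_prob Q Q0 \<alpha> p \<epsilon> i - c i * \<alpha> i) \<partial>bias_distr \<epsilon>0)"

definition pricing_equilibrium ::
  "(seller \<Rightarrow> real) \<Rightarrow> (seller \<Rightarrow> real) \<Rightarrow> real \<Rightarrow> real \<Rightarrow>
   (seller \<Rightarrow> real) \<Rightarrow> (seller \<Rightarrow> real) \<Rightarrow> bool" where
  "pricing_equilibrium Q c Q0 \<epsilon>0 \<alpha> p \<longleftrightarrow>
     (\<forall>i. 0 \<le> p i) \<and>
     (\<forall>i q. 0 \<le> q \<longrightarrow>
        expected_profit Q c Q0 \<epsilon>0 \<alpha> (p(i := q)) i \<le> expected_profit Q c Q0 \<epsilon>0 \<alpha> p i)"

end

theory Submission imports Defs begin

(* Without disclosure the bias shifts both payoffs equally, so the winner does not depend on it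
   and the pricing game is Bertrand competition at zero cost: a seller facing a positive rival
   price gains by undercutting it, which rules out every price pair except (0, 0). *)

lemma rival_neq [simp]: "rival i \<noteq> i"
  by (cases i) auto

lemma all_seller: "(\<forall>i. P i) \<longleftrightarrow> P S1 \<and> P S2"
  by (metis seller.exhaust)

lemma prob_space_bias_distr:
  assumes "0 < \<epsilon>0"
  shows "prob_space (bias_distr \<epsilon>0)"
  unfolding bias_distr_def using assms by (intro prob_space_uniform_measure) auto

text \<open>Both payoffs reduce to \<open>Q0 + \<epsilon>\<close> minus the price, so the integrand
  is constant in \<open>\<epsilon>\<close> and integrates to itself over a probability space; the
  privacy cost vanishes with \<alpha>.\<close>

lemma expected_profit_no_disclosure:
  assumes "0 < \<epsilon>0" and "\<And>j. \<alpha> j = 0"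
  shows "expected_profit Q c Q0 \<epsilon>0 \<alpha> p i =
           (if p i < p (rival i) then p i
            else if p i = p (rival i) then p i / 2
            else 0)"
proof -
  interpret prob_space "bias_distr \<epsilon>0"
    using assms(1) by (rule prob_space_bias_distr)
  have "win_prob Q Q0 \<alpha> p \<epsilon> i =
      (if p i < p (rival i) then 1 else if p i = p (rival i) then 1 / 2 else 0)" for \<epsilon>
    by (auto simp: win_prob_def buyer_payoff_def assms(2))
  then show ?thesis
    by (simp add: expected_profit_def assms(2) prob_space)
qed

text \<open>A positive price at the rival leaves the weakly cheaper seller a better reply: raise a
  strictly lower price, or slightly undercut a tie.\<close>

lemma pricing_equilibrium_rival_price_zero:
  assumes "0 < \<epsilon>0" and "\<And>j. \<alpha> j = 0"
    and eq: "pricing_equilibrium Q c Q0 \<epsilon>0 \<alpha> p" and le: "p i \<le> p (rival i)"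
  shows "p (rival i) = 0"
proof (rule ccontr)
  note profit = expected_profit_no_disclosure[OF assms(1,2)]
  assume "p (rival i) \<noteq> 0"
  moreover have "0 \<le> p i" "0 \<le> p (rival i)"
    using eq by (auto simp: pricing_equilibrium_def)
  ultimately have "0 < p (rival i)"
    by simp
  \<comment> \<open>Any price strictly below the rival's wins surely and earns itself, so
    equilibrium profit bounds all such prices.\<close>
  have no_gain: "q \<le> expected_profit Q c Q0 \<epsilon>0 \<alpha> p i" if "0 \<le> q" "q < p (rival i)" for q
  proof -
    have "expected_profit Q c Q0 \<epsilon>0 \<alpha> (p(i := q)) i = q"
      using that by (simp add: profit)
    then show ?thesis
      using eq that(1) unfolding pricing_equilibrium_def by metis
  qed
  show False
  proof (cases "p i < p (rival i)")
    case True
    then show False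
      \<comment> \<open>The current profit is \<open>p i\<close>; the midpoint still wins and earns
        more.\<close>
      using no_gain[of "(p i + p (rival i)) / 2"] \<open>0 \<le> p i\<close> by (simp add: profit)
  next
    case False
    with le have "p i = p (rival i)"
      by simp
    then show False
      \<comment> \<open>A tie yields only half of \<open>p i\<close>; any factor strictly between
        1/2 and 1 both undercuts and improves on it.\<close>
      using no_gain[of "3 / 4 * p i"] \<open>0 < p (rival i)\<close> by (simp add: profit)
  qed
qed

lemma pricing_equilibrium_no_disclosure_iff:
  assumes "0 < \<epsilon>0" and "\<And>j. \<alpha> j = 0"
  shows "pricing_equilibrium Q c Q0 \<epsilon>0 \<alpha> p \<longleftrightarrow> (\<forall>i. p i = 0)"
proof
  assume eq: "pricing_equilibrium Q c Q0 \<epsilon>0 \<alpha> p"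
  then have "0 \<le> p S1" "0 \<le> p S2"
    by (auto simp: pricing_equilibrium_def)
  \<comment> \<open>Whichever price is the larger is zero, and nonnegativity then forces the other
    to zero.\<close>
  moreover have "p S1 \<le> p S2 \<Longrightarrow> p S2 = 0" "p S2 \<le> p S1 \<Longrightarrow> p S1 = 0"
    using pricing_equilibrium_rival_price_zero[OF assms eq, of S1]
      pricing_equilibrium_rival_price_zero[OF assms eq, of S2] by simp_all
  ultimately show "\<forall>i. p i = 0"
    unfolding all_seller by linarith
next
  assume "\<forall>i. p i = 0"
  then show "pricing_equilibrium Q c Q0 \<epsilon>0 \<alpha> p"
    \<comment> \<open>Against a zero price, a positive deviation loses the buyer and a zero price
      earns nothing, so no deviation gains.\<close>
    by (auto simp: pricing_equilibrium_def expected_profit_no_disclosure[OF assms])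
qed

text \<open>The first conjunct makes the degeneration precise: expected profits are Bertrand
  payoffs. The equivalence gives both existence and uniqueness of the equilibrium.\<close>

theorem proposition2:
  fixes Q c \<alpha> :: "seller \<Rightarrow> real" and Q0 \<epsilon>0 :: real
  assumes "Q S2 \<le> Q S1" and "0 \<le> Q S2"
    and "\<And>i. 0 \<le> c i"
    and "0 < \<epsilon>0" and "\<epsilon>0 \<le> Q0 / 3"
    and "\<alpha> S1 = 0" and "\<alpha> S2 = 0"
  shows "(\<forall>p. (\<forall>i. 0 \<le> p i) \<longrightarrow>
            (\<forall>i. expected_profit Q c Q0 \<epsilon>0 \<alpha> p i =
                   (if p i < p (rival i) then p i
                    else if p i = p (rival i) then p i / 2
                    else 0)))
       \<and> (\<forall>p. pricing_equilibrium Q c Q0 \<epsilon>0 \<alpha> p \<longleftrightarrow> p S1 = 0 \<and> p S2 = 0)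
       \<and> (\<forall>p. pricing_equilibrium Q c Q0 \<epsilon>0 \<alpha> p \<longrightarrow>
            expected_profit Q c Q0 \<epsilon>0 \<alpha> p S1 = 0 \<and> expected_profit Q c Q0 \<epsilon>0 \<alpha> p S2 = 0)"
proof -
  have no_disclosure: "\<alpha> j = 0" for j
    using assms(6,7) by (cases j) auto
  note profit = expected_profit_no_disclosure[OF \<open>0 < \<epsilon>0\<close> no_disclosure]
  show ?thesis
    by (auto simp: profit pricing_equilibrium_no_disclosure_iff[OF \<open>0 < \<epsilon>0\<close> no_disclosure]
        all_seller)
qed

end
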